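(* Let $S$ be a commutative entire semiring and let $\sigma$ be an endomorphism on $S$ with $\ker(\sigma)=\{0\}$. Then the $\sigma$-expectation semiring $(S\widetilde{\oplus}S)_\sigma$ is reversible.
   Context: A semiring is an algebraic structure $(S,+,\cdot,0,1)$ such that $(S,+,0)$ is a commutative monoid, $(S,\cdot,1)$ is a monoid with $1\neq 0$, multiplication distributes over addition on both sides, and $a\cdot 0=0\cdot a=0$ for all $a\in S$. It is commutative if its multiplication is commutative, and entire if $ab=0$ implies $a=0$ or $b=0$. An endomorphism on $S$ is a semiring homomorphism $\sigma:S\to S$, and $\ker(\sigma)=\{s\in S:\sigma(s)=0\}$. A semiring is reversible if $st=0$ implies $ts=0$ for all its elements $s,t$. For a commutative semiring $S$, an $S$-semimodule $M$ and an endomorphism $\sigma$ on $S$, the $\sigma$-expectation semiring $(S\widetilde{\oplus}M)_\sigma$ is the set $S\times M$ with componentwise addition and multiplication $(s_1,m_1)\cdot(s_2,m_2)=(s_1s_2,\,\sigma(s_1)m_2+m_1s_2)$, where $ms:=sm$ for $s\in S$, $m\in M$. Here $M=S$ as a semimodule over itself. *)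

theory Defs
  imports "HOL-Algebra.Module" "HOL-Algebra.RingHom"
begin

text \<open>The library locale \<^locale>\<open>semiring\<close> permits the one-element semiring; here
  \<open>\<one> \<noteq> \<zero>\<close> is part of the definition.\<close>

locale nontrivial_semiring = semiring R for R (structure) +
  assumes one_not_zero: "\<one> \<noteq> \<zero>"

locale commutative_semiring = nontrivial_semiring R + comm_monoid R for R (structure)

locale entire_semiring = nontrivial_semiring R for R (structure) +
  assumes entire:
    "\<lbrakk>a \<in> carrier R; b \<in> carrier R; a \<otimes> b = \<zero>\<rbrakk> \<Longrightarrow> a = \<zero> \<or> b = \<zero>"

locale reversible_semiring = nontrivial_semiring R for R (structure) +
  assumes reversible:
    "\<lbrakk>s \<in> carrier R; t \<in> carrier R; s \<otimes> t = \<zero>\<rbrakk> \<Longrightarrow> t \<otimes> s = \<zero>"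

text \<open>Without additive inverses, preservation of \<open>\<zero>\<close> does not follow from the conditions in
  \<^const>\<open>ring_hom\<close>.\<close>

definition semiring_hom ::
    "('a, 'm) ring_scheme \<Rightarrow> ('b, 'n) ring_scheme \<Rightarrow> ('a \<Rightarrow> 'b) set" where
  "semiring_hom R S = {h \<in> ring_hom R S. h \<zero>\<^bsub>R\<^esub> = \<zero>\<^bsub>S\<^esub>}"

abbreviation semiring_endomorphisms :: "('a, 'm) ring_scheme \<Rightarrow> ('a \<Rightarrow> 'a) set" where
  "semiring_endomorphisms S \<equiv> semiring_hom S S"

text \<open>As in \<^locale>\<open>module\<close>, the multiplicative fields of the record \<open>M\<close> are irrelevant.\<close>

locale semimodule = S?: commutative_semiring S + M?: abelian_monoid M
  for S :: "('a, 's) ring_scheme" (structure) and M :: "('a, 'b, 'm) module_scheme" (structure) +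
  assumes smult_closed [simp, intro]:
      "\<lbrakk>a \<in> carrier S; x \<in> carrier M\<rbrakk> \<Longrightarrow> a \<odot>\<^bsub>M\<^esub> x \<in> carrier M"
    and smult_l_distr:
      "\<lbrakk>a \<in> carrier S; b \<in> carrier S; x \<in> carrier M\<rbrakk> \<Longrightarrow>
        (a \<oplus>\<^bsub>S\<^esub> b) \<odot>\<^bsub>M\<^esub> x = a \<odot>\<^bsub>M\<^esub> x \<oplus>\<^bsub>M\<^esub> b \<odot>\<^bsub>M\<^esub> x"
    and smult_r_distr:
      "\<lbrakk>a \<in> carrier S; x \<in> carrier M; y \<in> carrier M\<rbrakk> \<Longrightarrow>
        a \<odot>\<^bsub>M\<^esub> (x \<oplus>\<^bsub>M\<^esub> y) = a \<odot>\<^bsub>M\<^esub> x \<oplus>\<^bsub>M\<^esub> a \<odot>\<^bsub>M\<^esub> y"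
    and smult_assoc:
      "\<lbrakk>a \<in> carrier S; b \<in> carrier S; x \<in> carrier M\<rbrakk> \<Longrightarrow>
        (a \<otimes>\<^bsub>S\<^esub> b) \<odot>\<^bsub>M\<^esub> x = a \<odot>\<^bsub>M\<^esub> (b \<odot>\<^bsub>M\<^esub> x)"
    and smult_one [simp]: "x \<in> carrier M \<Longrightarrow> \<one>\<^bsub>S\<^esub> \<odot>\<^bsub>M\<^esub> x = x"
    and smult_l_zero [simp]: "x \<in> carrier M \<Longrightarrow> \<zero>\<^bsub>S\<^esub> \<odot>\<^bsub>M\<^esub> x = \<zero>\<^bsub>M\<^esub>"
    and smult_r_zero [simp]: "a \<in> carrier S \<Longrightarrow> a \<odot>\<^bsub>M\<^esub> \<zero>\<^bsub>M\<^esub> = \<zero>\<^bsub>M\<^esub>"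

definition regular_semimodule :: "('a, 's) ring_scheme \<Rightarrow> ('a, 'a) module" where
  "regular_semimodule S =
    \<lparr>carrier = carrier S, monoid.mult = monoid.mult S, one = one S, zero = zero S, add = add S, smult = monoid.mult S\<rparr>"

text \<open>The right action \<open>m\<^sub>1 s\<^sub>2\<close> in the product is by convention the left action of \<open>s\<^sub>2\<close> on \<open>m\<^sub>1\<close>.\<close>

definition expectation_semiring ::
    "('a, 's) ring_scheme \<Rightarrow> ('a, 'b, 'm) module_scheme \<Rightarrow> ('a \<Rightarrow> 'a) \<Rightarrow> ('a \<times> 'b) ring" where
  "expectation_semiring S M \<sigma> =
    \<lparr>carrier = carrier S \<times> carrier M,
     monoid.mult = (\<lambda>(s\<^sub>1, m\<^sub>1) (s\<^sub>2, m\<^sub>2).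
       (s\<^sub>1 \<otimes>\<^bsub>S\<^esub> s\<^sub>2, (\<sigma> s\<^sub>1 \<odot>\<^bsub>M\<^esub> m\<^sub>2) \<oplus>\<^bsub>M\<^esub> (s\<^sub>2 \<odot>\<^bsub>M\<^esub> m\<^sub>1))),
     one = (\<one>\<^bsub>S\<^esub>, \<zero>\<^bsub>M\<^esub>),
     zero = (\<zero>\<^bsub>S\<^esub>, \<zero>\<^bsub>M\<^esub>),
     add = (\<lambda>(s\<^sub>1, m\<^sub>1) (s\<^sub>2, m\<^sub>2). (s\<^sub>1 \<oplus>\<^bsub>S\<^esub> s\<^sub>2, m\<^sub>1 \<oplus>\<^bsub>M\<^esub> m\<^sub>2))\<rparr>"

lemma (in commutative_semiring) regular_semimodule: "semimodule R (regular_semimodule R)"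
proof -
  interpret M: abelian_monoid "regular_semimodule R"
    by (rule abelian_monoidI) (auto simp: regular_semimodule_def a_ac)
  show ?thesis
    by unfold_locales (auto simp: regular_semimodule_def l_distr r_distr m_assoc)
qed

lemma (in semimodule) expectation_semiring:
  assumes "\<sigma> \<in> semiring_endomorphisms S"
  shows "nontrivial_semiring (expectation_semiring S M \<sigma>)"
proof -
  have closed: "\<And>x. x \<in> carrier S \<Longrightarrow> \<sigma> x \<in> carrier S"
    and hom: "\<And>x y. \<lbrakk>x \<in> carrier S; y \<in> carrier S\<rbrakk> \<Longrightarrow> \<sigma> (x \<otimes>\<^bsub>S\<^esub> y) = \<sigma> x \<otimes>\<^bsub>S\<^esub> \<sigma> y"
      "\<And>x y. \<lbrakk>x \<in> carrier S; y \<in> carrier S\<rbrakk> \<Longrightarrow> \<sigma> (x \<oplus>\<^bsub>S\<^esub> y) = \<sigma> x \<oplus>\<^bsub>S\<^esub> \<sigma> y"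
      "\<sigma> \<one>\<^bsub>S\<^esub> = \<one>\<^bsub>S\<^esub>" "\<sigma> \<zero>\<^bsub>S\<^esub> = \<zero>\<^bsub>S\<^esub>"
    using assms by (auto simp: semiring_hom_def ring_hom_def)
  have swap: "a \<odot>\<^bsub>M\<^esub> (b \<odot>\<^bsub>M\<^esub> x) = b \<odot>\<^bsub>M\<^esub> (a \<odot>\<^bsub>M\<^esub> x)"
    if "a \<in> carrier S" "b \<in> carrier S" "x \<in> carrier M" for a b x
    using that by (metis smult_assoc S.m_comm)
  interpret E: abelian_monoid "expectation_semiring S M \<sigma>"
    by (rule abelian_monoidI)
      (auto simp: expectation_semiring_def S.a_ac M.a_ac)
  interpret E: monoid "expectation_semiring S M \<sigma>"
    by (rule monoidI)
      (auto simp: expectation_semiring_def closed hom S.m_assoc smult_assoc smult_r_distr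
        M.a_assoc swap)
  show ?thesis
    by unfold_locales
      (auto simp: expectation_semiring_def closed hom S.l_distr S.r_distr smult_l_distr
        smult_r_distr M.a_ac S.one_not_zero)
qed

end

theory Submission
  imports Defs
begin

text \<open>If \<open>(s, m)(t, n) = 0\<close>, then \<open>st = 0\<close>, so \<open>s = 0\<close>
  or \<open>t = 0\<close> because S is entire. Either way one summand of the second coordinate
  \<open>\<sigma>(s)n + tm\<close> vanishes, so the other is zero without any subtraction. As
  \<sigma> sends exactly 0 to 0, and a product in S is zero only when a factor is, \<sigma> can be
  inserted or removed on a factor of a zero product. This makes \<open>\<sigma>(t)m + sn\<close>
  zero too.\<close>

theorem proposition4p9:
  fixes S :: "('a, 's) ring_scheme" and \<sigma> :: "'a \<Rightarrow> 'a"
  assumes "commutative_semiring S"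
    and "entire_semiring S"
    and "\<sigma> \<in> semiring_endomorphisms S"
    and "a_kernel S S \<sigma> = {\<zero>\<^bsub>S\<^esub>}"
  shows "reversible_semiring (expectation_semiring S (regular_semimodule S) \<sigma>)"
proof -
  interpret S: commutative_semiring S by fact
  interpret S: entire_semiring S by fact
  interpret E: nontrivial_semiring "expectation_semiring S (regular_semimodule S) \<sigma>"
    by (rule semimodule.expectation_semiring[OF S.regular_semimodule assms(3)])
  have closed: "\<sigma> x \<in> carrier S" if "x \<in> carrier S" for x
    using assms(3) that by (auto simp: semiring_hom_def ring_hom_def)
  have ker: "\<sigma> x = \<zero>\<^bsub>S\<^esub> \<longleftrightarrow> x = \<zero>\<^bsub>S\<^esub>" if "x \<in> carrier S" for x
    using assms(4) that by (auto simp: a_kernel_def kernel_def)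
  have mult_eq_zero: "x \<otimes>\<^bsub>S\<^esub> y = \<zero>\<^bsub>S\<^esub> \<longleftrightarrow> x = \<zero>\<^bsub>S\<^esub> \<or> y = \<zero>\<^bsub>S\<^esub>"
    if "x \<in> carrier S" "y \<in> carrier S" for x y
    using that S.entire by auto
  \<comment> \<open>This is the second coordinate of \<open>(t, n)(s, m)\<close>, and
    \<open>sum\<close> is that of \<open>(s, m)(t, n)\<close>.\<close>
  have "\<sigma> t \<otimes>\<^bsub>S\<^esub> m \<oplus>\<^bsub>S\<^esub> s \<otimes>\<^bsub>S\<^esub> n = \<zero>\<^bsub>S\<^esub>"
    if S: "s \<in> carrier S" "m \<in> carrier S" "t \<in> carrier S" "n \<in> carrier S"
      and st: "s \<otimes>\<^bsub>S\<^esub> t = \<zero>\<^bsub>S\<^esub>"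
      and sum: "\<sigma> s \<otimes>\<^bsub>S\<^esub> n \<oplus>\<^bsub>S\<^esub> t \<otimes>\<^bsub>S\<^esub> m = \<zero>\<^bsub>S\<^esub>"
    for s m t n
  proof -
    consider "s = \<zero>\<^bsub>S\<^esub>" | "t = \<zero>\<^bsub>S\<^esub>"
      using S st mult_eq_zero by blast
    then show ?thesis
    proof cases
      case 1
      then have "\<sigma> s = \<zero>\<^bsub>S\<^esub>" using ker by simp
      then have "t \<otimes>\<^bsub>S\<^esub> m = \<zero>\<^bsub>S\<^esub>" using S sum by simp
      \<comment> \<open>Either \<open>m\<close> is zero, or \<open>t\<close> is and then so is its
        image.\<close>
      then have "\<sigma> t \<otimes>\<^bsub>S\<^esub> m = \<zero>\<^bsub>S\<^esub>" using S closed ker mult_eq_zero by auto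
      then show ?thesis using 1 S by simp
    next
      case 2
      then have "\<sigma> t = \<zero>\<^bsub>S\<^esub>" using ker by simp
      moreover have "\<sigma> s \<otimes>\<^bsub>S\<^esub> n = \<zero>\<^bsub>S\<^esub>" using 2 S sum closed by simp
      \<comment> \<open>The trivial kernel is essential here: \<open>\<sigma> s = \<zero>\<close>
        must force \<open>s = \<zero>\<close>.\<close>
      then have "s \<otimes>\<^bsub>S\<^esub> n = \<zero>\<^bsub>S\<^esub>" using S closed ker mult_eq_zero by auto
      ultimately show ?thesis using S by simp
    qed
  qed
  then show ?thesis
    \<comment> \<open>Commutativity of S settles the first coordinate, turning \<open>st = 0\<close>
      into \<open>ts = 0\<close>.\<close>
    by unfold_locales
      (auto simp: expectation_semiring_def regular_semimodule_def S.m_comm)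
qed

end
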